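(* (Chernoff bounds) Let $(E,e,T)$ be a conditional Riesz triple, $x$ a natural element in $E$ and $u\in R(T)$. Then $$TP_{x\ge u}e\le s^{-u}g_x(s)\quad\text{for all } s>1,$$ $$TP_{x\le u}e\le s^{-u}g_x(s)\quad\text{for all } 0<s<1.$$
   Context: A conditional Riesz triple $(E,e,T)$ consists of a Dedekind complete Riesz space $E$ with weak order unit $e$ and a conditional expectation operator $T$ on $E$, i.e. a positive order continuous projection with $Te=e$ whose range $R(T)$ is a Dedekind complete Riesz subspace; $T$ is also assumed strictly positive ($f>0\Rightarrow Tf>0$). $E^u$ is the universal completion of $E$, an $f$-algebra with multiplicative unit $e$; $E^s$ is the sup-completion of $E$ (every non-empty subset of $E^s_+$ has a supremum; $E^u_+\subset E^s_+$). $T$ and the multiplication extend to $E^s_+$ by suprema of increasing nets. $P_z$ is the band projection onto the band generated by $z$, $P^d=I-P$; $P_{x\ge y}=P^d_{(y-x)^+}$, $P_{x\le y}=P_{y\ge x}$, and $P_{x=y}=P^d_{|x-y|}$. The $T$-mass function of $x\in E$ is $\pi_x(t)=TP_{x=te}e$, $t\in\mathbb R$; $x$ is natural if $\sum_{n=0}^\infty \pi_x(n)=e$ (order sum). The $T$-generating function of a natural $x$ is $g_x:[0,\infty)\to E^s$, $g_x(s)=\sum_{n\ge0}s^n\pi_x(n)$. For $s>0$ and $u\in E$, $s^u=\exp((\log s)u)\in E^u$ is defined by functional calculus (pointwise in a representation of $E^u$ as a space $C^\infty(K)$ with $e$ corresponding to the constant function $1$). *)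

theory Defs
  imports "HOL-Analysis.Analysis" "HOL-Library.Lub_Glb"
begin

section \<open>Dedekind complete Riesz spaces and band projections\<close>

class dedekind_riesz = ordered_real_vector + conditionally_complete_lattice

definition rabs :: "'a::dedekind_riesz \<Rightarrow> 'a" where
  "rabs x = sup x (- x)"

definition rpos :: "'a::dedekind_riesz \<Rightarrow> 'a" where
  "rpos x = sup x 0"

definition rdisjoint :: "'a::dedekind_riesz \<Rightarrow> 'a \<Rightarrow> bool" where
  "rdisjoint x y \<longleftrightarrow> inf (rabs x) (rabs y) = 0"

definition disjoint_complement :: "'a::dedekind_riesz set \<Rightarrow> 'a set" where
  "disjoint_complement B = {x. \<forall>y\<in>B. rdisjoint x y}"

definition is_band :: "'a::dedekind_riesz set \<Rightarrow> bool" where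
  "is_band B \<longleftrightarrow> subspace B \<and>
     (\<forall>x y. y \<in> B \<longrightarrow> rabs x \<le> rabs y \<longrightarrow> x \<in> B) \<and>
     (\<forall>A s. A \<subseteq> B \<longrightarrow> A \<noteq> {} \<longrightarrow> isLub UNIV A s \<longrightarrow> s \<in> B)"

definition generated_band :: "'a::dedekind_riesz \<Rightarrow> 'a set" where
  "generated_band z = \<Inter> {B. is_band B \<and> z \<in> B}"

text \<open>In a Dedekind complete space every band \<open>B\<close> satisfies \<open>E = B \<oplus> B\<^sup>d\<close>, so the description
  below is always uniquely satisfied.\<close>

definition band_proj :: "'a::dedekind_riesz \<Rightarrow> 'a \<Rightarrow> 'a" where
  "band_proj z x =
     (THE y. y \<in> generated_band z \<and> x - y \<in> disjoint_complement (generated_band z))"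

definition band_proj_d :: "'a::dedekind_riesz \<Rightarrow> 'a \<Rightarrow> 'a" where
  "band_proj_d z x = x - band_proj z x"

definition proj_ge :: "'a::dedekind_riesz \<Rightarrow> 'a \<Rightarrow> 'a \<Rightarrow> 'a" where
  "proj_ge x y = band_proj_d (rpos (y - x))"

definition proj_le :: "'a::dedekind_riesz \<Rightarrow> 'a \<Rightarrow> 'a \<Rightarrow> 'a" where
  "proj_le x y = proj_ge y x"

definition proj_eq :: "'a::dedekind_riesz \<Rightarrow> 'a \<Rightarrow> 'a \<Rightarrow> 'a" where
  "proj_eq x y = band_proj_d (rabs (x - y))"

section \<open>Conditional Riesz triples\<close>

definition weak_order_unit :: "'a::dedekind_riesz \<Rightarrow> bool" where
  "weak_order_unit e \<longleftrightarrow> 0 \<le> e \<and> (\<forall>x. rdisjoint x e \<longrightarrow> x = 0)"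

text \<open>Order continuity, for a positive linear operator: \<open>x\<^sub>\<alpha> \<down> 0\<close> implies \<open>T x\<^sub>\<alpha> \<down> 0\<close>.  A decreasing
  net is represented by its range, a downward directed set.\<close>

definition order_continuous :: "('a::dedekind_riesz \<Rightarrow> 'a) \<Rightarrow> bool" where
  "order_continuous T \<longleftrightarrow>
     (\<forall>D. D \<noteq> {} \<longrightarrow> (\<forall>a\<in>D. \<forall>b\<in>D. \<exists>c\<in>D. c \<le> a \<and> c \<le> b) \<longrightarrow>
        isGlb UNIV D 0 \<longrightarrow> isGlb UNIV (T ` D) 0)"

text \<open>Here Dedekind completeness is that of \<open>R\<close> as an ordered space in its own right: suprema are
  formed inside \<open>R\<close>.\<close>

definition dedekind_complete_riesz_subspace :: "'a::dedekind_riesz set \<Rightarrow> bool" where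
  "dedekind_complete_riesz_subspace R \<longleftrightarrow> subspace R \<and>
     (\<forall>x\<in>R. \<forall>y\<in>R. sup x y \<in> R \<and> inf x y \<in> R) \<and>
     (\<forall>A. A \<subseteq> R \<longrightarrow> A \<noteq> {} \<longrightarrow> (\<exists>b. isUb R A b) \<longrightarrow> (\<exists>s. isLub R A s))"

definition conditional_riesz_triple :: "'a::dedekind_riesz \<Rightarrow> ('a \<Rightarrow> 'a) \<Rightarrow> bool" where
  "conditional_riesz_triple e T \<longleftrightarrow>
     weak_order_unit e \<and>
     linear T \<and> (\<forall>f. 0 \<le> f \<longrightarrow> 0 \<le> T f) \<and> order_continuous T \<and>
     (\<forall>f. T (T f) = T f) \<and> T e = e \<and>
     dedekind_complete_riesz_subspace (range T) \<and>
     (\<forall>f. 0 < f \<longrightarrow> 0 < T f)"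

definition mass_function ::
    "'a::dedekind_riesz \<Rightarrow> ('a \<Rightarrow> 'a) \<Rightarrow> 'a \<Rightarrow> real \<Rightarrow> 'a" where
  "mass_function e T x t = T (proj_eq x (t *\<^sub>R e) e)"

text \<open>The mass function takes positive values, so the order sum is the supremum of the increasing
  sequence of partial sums.\<close>

definition natural_element :: "'a::dedekind_riesz \<Rightarrow> ('a \<Rightarrow> 'a) \<Rightarrow> 'a \<Rightarrow> bool" where
  "natural_element e T x \<longleftrightarrow>
     isLub UNIV (range (\<lambda>N. \<Sum>n\<le>N. mass_function e T x (real n))) e"

section \<open>The universal completion\<close>

class dedekind_f_algebra = dedekind_riesz + real_algebra +
  assumes f_mult_nonneg: "0 \<le> a \<Longrightarrow> 0 \<le> b \<Longrightarrow> 0 \<le> a * b"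
    and f_disjoint_left: "inf a b = 0 \<Longrightarrow> 0 \<le> c \<Longrightarrow> inf (c * a) b = 0"
    and f_disjoint_right: "inf a b = 0 \<Longrightarrow> 0 \<le> c \<Longrightarrow> inf (a * c) b = 0"

definition laterally_complete :: "'u::dedekind_riesz itself \<Rightarrow> bool" where
  "laterally_complete _ \<longleftrightarrow>
     (\<forall>A :: 'u set. (\<forall>a\<in>A. 0 \<le> a) \<longrightarrow> pairwise rdisjoint A \<longrightarrow> bdd_above A)"

text \<open>The whole type \<open>'u\<close> is \<open>E\<^sup>u\<close>, and \<open>\<iota>\<close> is the inclusion of \<open>E\<close> as an order dense Riesz
  subspace.  The multiplication of \<open>E\<^sup>u\<close> is the \<open>f\<close>-algebra multiplication with unit \<open>\<iota> e\<close>.  The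
  class \<open>real_algebra\<close> rather than \<open>real_algebra_1\<close> is used since the latter forces \<open>0 \<noteq> 1\<close> and
  would exclude the zero space.\<close>

definition universal_completion ::
    "'a::dedekind_riesz \<Rightarrow> ('a \<Rightarrow> 'u::dedekind_f_algebra) \<Rightarrow> bool" where
  "universal_completion e \<iota> \<longleftrightarrow>
     laterally_complete TYPE('u) \<and>
     linear \<iota> \<and> inj \<iota> \<and>
     (\<forall>x y. \<iota> (sup x y) = sup (\<iota> x) (\<iota> y) \<and> \<iota> (inf x y) = inf (\<iota> x) (\<iota> y)) \<and>
     (\<forall>v>0. \<exists>x>0. \<iota> x \<le> v) \<and>
     (\<forall>v. \<iota> e * v = v \<and> v * \<iota> e = v)"

section \<open>Representation by extended real valued continuous functions\<close>

definition extremally_disconnected :: "'k topology \<Rightarrow> bool" where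
  "extremally_disconnected K \<longleftrightarrow> (\<forall>U. openin K U \<longrightarrow> openin K (K closure_of U))"

definition C_infinity :: "'k topology \<Rightarrow> ('k \<Rightarrow> ereal) set" where
  "C_infinity K = {f \<in> extensional (topspace K). continuous_map K euclidean f \<and>
     K closure_of {k \<in> topspace K. \<bar>f k\<bar> \<noteq> \<infinity>} = topspace K}"

text \<open>\<open>\<Phi>\<close> is a Riesz isomorphism of the space onto \<open>C\<^sup>\<infinity>(K)\<close> that maps \<open>w\<close> to the constant function
  \<open>1\<close>.  The linear operations of \<open>C\<^sup>\<infinity>(K)\<close> are determined by their values on the dense set where the
  arguments are finite.\<close>

definition C_infinity_representation ::
    "'u::dedekind_riesz \<Rightarrow> 'k topology \<Rightarrow> ('u \<Rightarrow> 'k \<Rightarrow> ereal) \<Rightarrow> bool" where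
  "C_infinity_representation w K \<Phi> \<longleftrightarrow>
     compact_space K \<and> Hausdorff_space K \<and> extremally_disconnected K \<and>
     bij_betw \<Phi> UNIV (C_infinity K) \<and>
     (\<forall>u v. u \<le> v \<longleftrightarrow> (\<forall>k\<in>topspace K. \<Phi> u k \<le> \<Phi> v k)) \<and>
     (\<forall>u v. \<forall>k\<in>topspace K. \<forall>a b. \<Phi> u k = ereal a \<longrightarrow> \<Phi> v k = ereal b \<longrightarrow>
        \<Phi> (u + v) k = ereal (a + b)) \<and>
     (\<forall>r u. \<forall>k\<in>topspace K. \<forall>a. \<Phi> u k = ereal a \<longrightarrow> \<Phi> (r *\<^sub>R u) k = ereal (r * a)) \<and>
     (\<forall>k\<in>topspace K. \<Phi> w k = 1)"

text \<open>For continuous \<open>h\<close>, the element \<open>h(v)\<close> is unique since functions in \<open>C\<^sup>\<infinity>(K)\<close> agreeing on a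
  dense set are equal, and it exists since \<open>K\<close> is extremally disconnected.\<close>

definition functional_calculus ::
    "'k topology \<Rightarrow> ('u \<Rightarrow> 'k \<Rightarrow> ereal) \<Rightarrow> (real \<Rightarrow> real) \<Rightarrow> 'u \<Rightarrow> 'u" where
  "functional_calculus K \<Phi> h v =
     (THE w. \<forall>k\<in>topspace K. \<forall>t. \<Phi> v k = ereal t \<longrightarrow> \<Phi> w k = ereal (h t))"

definition riesz_power ::
    "'k topology \<Rightarrow> ('u \<Rightarrow> 'k \<Rightarrow> ereal) \<Rightarrow> ('a \<Rightarrow> 'u::real_vector) \<Rightarrow> real \<Rightarrow> 'a \<Rightarrow> 'u" where
  "riesz_power K \<Phi> \<iota> s u = functional_calculus K \<Phi> exp (ln s *\<^sub>R \<iota> u)"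

section \<open>The sup-completion\<close>

text \<open>Because of the top element, every non-empty set is bounded above and hence has a supremum.
  Scalar multiplication is only meaningful for nonnegative scalars.\<close>

class sup_cone = conditionally_complete_lattice + order_top + ordered_comm_monoid_add + scaleR +
  assumes cone_scale_add: "0 \<le> r \<Longrightarrow> r *\<^sub>R (a + b) = r *\<^sub>R a + r *\<^sub>R b"
    and cone_add_scale: "0 \<le> r \<Longrightarrow> 0 \<le> t \<Longrightarrow> (r + t) *\<^sub>R a = r *\<^sub>R a + t *\<^sub>R a"
    and cone_scale_scale: "0 \<le> r \<Longrightarrow> 0 \<le> t \<Longrightarrow> r *\<^sub>R (t *\<^sub>R a) = (r * t) *\<^sub>R a"
    and cone_scale_one: "1 *\<^sub>R a = a"
    and cone_scale_zero: "0 *\<^sub>R a = 0"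
    and cone_scale_mono: "0 \<le> r \<Longrightarrow> a \<le> b \<Longrightarrow> r *\<^sub>R a \<le> r *\<^sub>R b"

text \<open>Donner's properties of the sup-completion, which determine it up to isomorphism: the whole type
  \<open>'s\<close> is \<open>E\<^sup>s\<close>, \<open>\<kappa>\<close> identifies \<open>E\<close> with the invertible elements of \<open>E\<^sup>s\<close>, this copy of \<open>E\<close> is
  downward closed and sup-dense, and addition and finite infima distribute over suprema.\<close>

definition sup_completion :: "('a::dedekind_riesz \<Rightarrow> 's::sup_cone) \<Rightarrow> bool" where
  "sup_completion \<kappa> \<longleftrightarrow>
     (\<forall>x y. \<kappa> x \<le> \<kappa> y \<longleftrightarrow> x \<le> y) \<and>
     (\<forall>x y. \<kappa> (x + y) = \<kappa> x + \<kappa> y) \<and>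
     (\<forall>r\<ge>0. \<forall>x. \<kappa> (r *\<^sub>R x) = r *\<^sub>R \<kappa> x) \<and>
     range \<kappa> = {y. \<exists>z. y + z = 0} \<and>
     (\<forall>y x. y \<le> \<kappa> x \<longrightarrow> y \<in> range \<kappa>) \<and>
     (\<forall>y. (\<exists>x. \<kappa> x \<le> y) \<and> y = Sup {\<kappa> x |x. \<kappa> x \<le> y}) \<and>
     (\<forall>A B :: 's set. A \<noteq> {} \<longrightarrow> B \<noteq> {} \<longrightarrow> Sup A + Sup B = Sup {a + b |a b. a \<in> A \<and> b \<in> B}) \<and>
     (\<forall>y. \<forall>A :: 's set. A \<noteq> {} \<longrightarrow> inf y (Sup A) = Sup {inf y a |a. a \<in> A})"

text \<open>The inclusion of the positive cone of \<open>E\<^sup>u\<close> into that of \<open>E\<^sup>s\<close>: an element \<open>v \<ge> 0\<close> of \<open>E\<^sup>u\<close> is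
  the supremum of the elements of \<open>E\<close> between \<open>0\<close> and \<open>v\<close>.\<close>

definition univ_to_sup ::
    "('a::dedekind_riesz \<Rightarrow> 'u::dedekind_f_algebra) \<Rightarrow> ('a \<Rightarrow> 's::sup_cone) \<Rightarrow> 'u \<Rightarrow> 's" where
  "univ_to_sup \<iota> \<kappa> v = Sup {\<kappa> x |x. 0 \<le> x \<and> \<iota> x \<le> v}"

text \<open>The extension of the multiplication to the positive cone of \<open>E\<^sup>s\<close> by suprema of increasing nets
  of positive elements of \<open>E\<^sup>u\<close>; meaningful for \<open>y, z \<ge> 0\<close> only.\<close>

definition sup_mult ::
    "('a::dedekind_riesz \<Rightarrow> 'u::dedekind_f_algebra) \<Rightarrow> ('a \<Rightarrow> 's::sup_cone) \<Rightarrow> 's \<Rightarrow> 's \<Rightarrow> 's" where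
  "sup_mult \<iota> \<kappa> y z =
     Sup {univ_to_sup \<iota> \<kappa> (v * w) |v w.
       0 \<le> v \<and> univ_to_sup \<iota> \<kappa> v \<le> y \<and> 0 \<le> w \<and> univ_to_sup \<iota> \<kappa> w \<le> z}"

definition generating_function ::
    "('a::dedekind_riesz \<Rightarrow> 's::sup_cone) \<Rightarrow> 'a \<Rightarrow> ('a \<Rightarrow> 'a) \<Rightarrow> 'a \<Rightarrow> real \<Rightarrow> 's" where
  "generating_function \<kappa> e T x s =
     (SUP N. \<Sum>n\<le>N. s ^ n *\<^sub>R \<kappa> (mass_function e T x (real n)))"

end

theory Submission
  imports Defs "HOL-Library.Lattice_Algebras"
begin

text \<open>
  Write \<open>d\<^sub>n = P\<^bsub>x = ne\<^esub> e\<close>, so that the mass function is \<open>\<pi>\<^sub>n = T d\<^sub>n\<close>, and let \<open>p\<close> be the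
  component of \<open>e\<close> whose expectation is to be bounded, \<open>P\<^bsub>x \<ge> u\<^esub> e\<close> for \<open>s > 1\<close> and
  \<open>P\<^bsub>x \<le> u\<^esub> e\<close> for \<open>s < 1\<close>.  The \<open>d\<^sub>n\<close> are disjoint, and naturality of \<open>x\<close> says that their
  expectations add up to \<open>e\<close>, so \<open>T p\<close> is recovered from the pieces \<open>T (inf p d\<^sub>n)\<close>.

  The classical argument bounds such a piece by pulling the factor \<open>s\<^sup>-\<^sup>u\<close> out of the conditional
  expectation.  Here the averaging property of \<open>T\<close> is replaced by a comparison of components.  Let
  \<open>q\<^sub>n\<close> be the component of \<open>e\<close> on which \<open>u \<le> n\<close> (if \<open>s > 1\<close>) or \<open>u \<ge> n\<close> (if \<open>s < 1\<close>).  On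
  \<open>inf p d\<^sub>n\<close> the element \<open>x\<close> equals \<open>n\<close> and is at least (or at most) \<open>u\<close>, hence
  \<open>inf p d\<^sub>n \<le> q\<^sub>n\<close>.  Since \<open>u\<close> is in the range of \<open>T\<close>, also \<open>T q\<^sub>n \<le> q\<^sub>n\<close>
  (\<open>conditional_expectation_band_proj_d_le\<close>), and therefore \<open>T (inf p d\<^sub>n) \<le> inf q\<^sub>n \<pi>\<^sub>n\<close>.

  In the universal completion \<open>s\<^sup>n s\<^sup>-\<^sup>u \<ge> q\<^sub>n\<close>, because \<open>s\<^sup>n s\<^sup>-\<^sup>u = exp ((n - u) ln s)\<close> is at least
  \<open>1\<close> where \<open>q\<^sub>n\<close> lives.  In an \<open>f\<close>-algebra, multiplying by the component \<open>q\<^sub>n\<close> of the unit restricts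
  to the band of \<open>q\<^sub>n\<close>, so \<open>inf q\<^sub>n \<pi>\<^sub>n \<le> q\<^sub>n \<pi>\<^sub>n \<le> s\<^sup>-\<^sup>u s\<^sup>n \<pi>\<^sub>n\<close> (\<open>component_inf_le_mult\<close>).
  Summation over \<open>n \<le> N\<close> bounds the partial sums by \<open>s\<^sup>-\<^sup>u g\<^sub>x(s)\<close>, and the limit \<open>N \<rightarrow> \<infinity>\<close> is
  \<open>natural_tail_bound\<close>.

  Two descriptions make these objects accessible.  For \<open>z, x \<ge> 0\<close> the band projection is
  \<open>P\<^sub>z x = sup\<^sub>k inf (k z) x\<close> (\<open>band_proj_eq_SUP\<close>), from which all properties of components follow.
  The exponential enters through its positivity and \<open>exp (c + t) \<ge> 1 + c + t\<close>, an inequality between elements of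
  \<open>E\<^sup>u\<close> (\<open>functional_calculus_exp_ge\<close>): for \<open>s > 1\<close>, as \<open>q\<^sub>n \<le> sup 0 (e - r (u - n e)\<^sup>+)\<close> for every real
  \<open>r\<close>, this linear lower bound for \<open>exp\<close> with \<open>r = ln s\<close> already gives \<open>q\<^sub>n \<le> s\<^sup>n s\<^sup>-\<^sup>u\<close>.  The case
  \<open>s < 1\<close> is the same with all signs reversed.
\<close>

section \<open>Disjointness in Riesz spaces\<close>

subclass (in dedekind_riesz) lattice_ab_group_add ..

lemma inf_add_le:
  fixes a b c :: "'a::dedekind_riesz"
  assumes "0 \<le> a" "0 \<le> b" "0 \<le> c"
  shows "inf (a + b) c \<le> inf a c + inf b c"
proof -
  let ?w = "inf (a + b) c"
  have w: "?w \<le> a + b" "?w \<le> c" by simp_all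
  have 1: "?w \<le> a + c"
    using w(2) assms(1) by (metis add_increasing)
  have 2: "?w \<le> c + b" using w(2) assms(2) by (metis add_increasing2)
  have 3: "?w \<le> c + c" using w(2) assms(3) by (metis add_increasing)
  have "inf a c + inf b c = inf (inf (a + b) (c + b)) (inf (a + c) (c + c))"
    by (simp add: add_inf_distrib_left add_inf_distrib_right)
  then show ?thesis using w(1) 1 2 3 by simp
qed

lemma disjoint_add:
  fixes a b c :: "'a::dedekind_riesz"
  assumes "inf a c = 0" "inf b c = 0"
  shows "inf (a + b) c = 0"
proof -
  have pos: "0 \<le> a" "0 \<le> b" "0 \<le> c"
    using assms by (metis inf.cobounded1 inf.cobounded2)+
  show ?thesis
  proof (rule order.antisym)
    show "inf (a + b) c \<le> 0" using inf_add_le[OF pos] assms by simp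
    show "0 \<le> inf (a + b) c" using pos by simp
  qed
qed

lemma disjoint_mono:
  fixes a b c :: "'a::dedekind_riesz"
  assumes "inf b c = 0" "0 \<le> a" "a \<le> b"
  shows "inf a c = 0"
proof (rule order.antisym)
  show "inf a c \<le> 0" using inf_mono[OF assms(3) order.refl, of c] assms(1) by simp
  show "0 \<le> inf a c" using assms by (metis inf.cobounded2 inf.boundedI)
qed

lemma disjoint_scaleR:
  fixes a c :: "'a::dedekind_riesz"
  assumes "inf a c = 0" "0 \<le> r"
  shows "inf (r *\<^sub>R a) c = 0"
proof (rule order.antisym)
  have pos: "0 \<le> a" "0 \<le> c" using assms by (metis inf.cobounded1 inf.cobounded2)+
  define m where "m = max 1 r"
  have m: "1 \<le> m" "r \<le> m" by (auto simp: m_def)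
  let ?w = "inf (r *\<^sub>R a) c"
  have "?w \<le> m *\<^sub>R a"
    by (rule order.trans[OF inf.cobounded1]) (use m pos in \<open>simp add: scaleR_right_mono\<close>)
  moreover have "?w \<le> m *\<^sub>R c"
    using scaleR_right_mono[OF m(1) pos(2)] by (simp add: le_infI2)
  ultimately have "inverse m *\<^sub>R ?w \<le> a" "inverse m *\<^sub>R ?w \<le> c"
    using scaleR_left_mono[of ?w _ "inverse m"] m by fastforce+
  then have "inverse m *\<^sub>R ?w \<le> 0" using assms(1) by (metis inf.boundedI)
  then have "m *\<^sub>R (inverse m *\<^sub>R ?w) \<le> m *\<^sub>R 0"
    using m by (intro scaleR_left_mono) auto
  then show "?w \<le> 0" using m by simp
  show "0 \<le> ?w" using pos assms(2) by (simp add: scaleR_nonneg_nonneg)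
qed

lemma disjoint_add_eq_sup:
  fixes a b :: "'a::dedekind_riesz"
  assumes "inf a b = 0"
  shows "a + b = sup a b"
  using add_eq_inf_sup[of a b] assms by simp

lemma disjoint_sum_le:
  fixes f :: "'i \<Rightarrow> 'a::dedekind_riesz"
  assumes "finite I" "\<And>i. i \<in> I \<Longrightarrow> 0 \<le> f i" "\<And>i. i \<in> I \<Longrightarrow> f i \<le> b" "0 \<le> b"
    "\<And>i j. i \<in> I \<Longrightarrow> j \<in> I \<Longrightarrow> i \<noteq> j \<Longrightarrow> inf (f i) (f j) = 0"
  shows "sum f I \<le> b"
proof -
  have disj: "inf (sum f J) (f j) = 0" if "finite J" "J \<subseteq> I" "j \<in> I" "j \<notin> J" for J j
    using that
  proof (induction J)
    case empty
    then show ?case using assms(2) by (simp add: inf.absorb1)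
  next
    case (insert i J)
    then have "inf (f i) (f j) = 0" using assms(5) by auto
    moreover have "inf (sum f J) (f j) = 0" using insert by auto
    ultimately show ?case using insert disjoint_add by simp
  qed
  have "sum f J \<le> b" if "finite J" "J \<subseteq> I" for J
    using that
  proof (induction J)
    case empty
    then show ?case using assms(4) by simp
  next
    case (insert i J)
    then have "f i + sum f J = sup (f i) (sum f J)"
      using disj[of J i] by (simp add: disjoint_add_eq_sup inf.commute)
    then show ?case using insert assms(3) by simp
  qed
  then show ?thesis using assms(1) by blast
qed

lemma inf_sum_le:
  fixes f :: "'i \<Rightarrow> 'a::dedekind_riesz"
  assumes "finite I" "\<And>i. i \<in> I \<Longrightarrow> 0 \<le> f i" "0 \<le> b"
  shows "inf b (sum f I) \<le> (\<Sum>i\<in>I. inf b (f i))"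
  using assms
proof (induction I)
  case empty
  then show ?case by simp
next
  case (insert i I)
  have "inf b (f i + sum f I) \<le> inf b (f i) + inf b (sum f I)"
    using inf_add_le[of "f i" "sum f I" b] insert by (simp add: inf.commute sum_nonneg)
  also have "\<dots> \<le> inf b (f i) + (\<Sum>i\<in>I. inf b (f i))"
    using insert by (intro add_left_mono) auto
  finally show ?case using insert by simp
qed

lemma rabs_nonneg: "0 \<le> rabs (x :: 'a::dedekind_riesz)"
proof -
  have "x \<le> rabs x" "- x \<le> rabs x" by (simp_all add: rabs_def)
  then have "0 \<le> rabs x + rabs x" using add_mono by fastforce
  then show ?thesis by simp
qed

lemma rabs_of_nonneg: "0 \<le> x \<Longrightarrow> rabs x = (x :: 'a::dedekind_riesz)"
  unfolding rabs_def by (metis neg_le_0_iff_le order.trans sup.absorb1)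

lemma rabs_add_le: "rabs (x + y) \<le> rabs x + rabs (y :: 'a::dedekind_riesz)"
proof -
  have "x \<le> rabs x" "- x \<le> rabs x" "y \<le> rabs y" "- y \<le> rabs y" by (simp_all add: rabs_def)
  then have "x + y \<le> rabs x + rabs y" "- x + - y \<le> rabs x + rabs y" by (blast intro: add_mono)+
  then show ?thesis unfolding rabs_def[of "x + y"] by (intro sup_least) (simp_all add: add.commute)
qed

lemma rabs_minus_commute: "rabs (x - y) = rabs (y - (x :: 'a::dedekind_riesz))"
  unfolding rabs_def by (simp add: sup.commute)

lemma rabs_scaleR_le: "rabs (r *\<^sub>R x) \<le> \<bar>r\<bar> *\<^sub>R rabs (x :: 'a::dedekind_riesz)"
proof -
  have "\<bar>r\<bar> *\<^sub>R x \<le> \<bar>r\<bar> *\<^sub>R rabs x" "\<bar>r\<bar> *\<^sub>R (- x) \<le> \<bar>r\<bar> *\<^sub>R rabs x"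
    by (intro scaleR_left_mono; simp add: rabs_def)+
  then show ?thesis by (cases "0 \<le> r") (auto simp: rabs_def)
qed

section \<open>Band projections of positive elements\<close>

text \<open>The disjoint complement of a single element is a band.  For closure under suprema: if every
  \<open>a\<^sup>+\<close> is disjoint from \<open>w = inf s\<^sup>+ b\<close>, then \<open>a\<^sup>+ + w\<close> is their supremum and stays below
  \<open>s\<^sup>+\<close>, so \<open>s\<^sup>+ - w\<close> is still an upper bound and \<open>w\<close> must vanish.  The negative part of \<open>s\<close> is
  controlled by that of any one element.\<close>

lemma is_band_disjoint:
  fixes b :: "'a::dedekind_riesz"
  assumes b: "0 \<le> b"
  shows "is_band {f. inf (rabs f) b = 0}" (is "is_band ?B")
  unfolding is_band_def
proof (intro conjI allI impI)
  show "subspace ?B"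
  proof (rule subspaceI)
    show "0 \<in> ?B" using b by (simp add: rabs_def inf.absorb1)
    show "x + y \<in> ?B" if "x \<in> ?B" "y \<in> ?B" for x y
    proof -
      have "inf (rabs x + rabs y) b = 0" using that disjoint_add by auto
      then show ?thesis using disjoint_mono[OF _ rabs_nonneg rabs_add_le] by auto
    qed
    show "r *\<^sub>R x \<in> ?B" if "x \<in> ?B" for r x
    proof -
      have "inf (\<bar>r\<bar> *\<^sub>R rabs x) b = 0" using that by (intro disjoint_scaleR) auto
      then show ?thesis using disjoint_mono[OF _ rabs_nonneg rabs_scaleR_le] by auto
    qed
  qed
next
  fix x y assume "y \<in> ?B" "rabs x \<le> rabs y"
  then show "x \<in> ?B" using disjoint_mono[OF _ rabs_nonneg] by auto
next
  fix A s assume A: "A \<subseteq> ?B" "A \<noteq> {}" "isLub UNIV A s"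
  let ?w = "inf (sup s 0) b"
  have ub: "a \<le> s" if "a \<in> A" for a using A(3) that isLubD2 by blast
  have "sup a 0 \<le> sup s 0 - ?w" if a: "a \<in> A" for a
  proof -
    have "inf (sup a 0) b = 0"
    proof (rule disjoint_mono[of "rabs a"])
      show "inf (rabs a) b = 0" using a A by auto
      show "sup a 0 \<le> rabs a" using rabs_nonneg[of a] by (simp add: rabs_def)
    qed simp
    then have "inf ?w (sup a 0) = 0"
      using disjoint_mono[of b "sup a 0" ?w] b by (simp add: inf.commute)
    then have "?w + sup a 0 = sup ?w (sup a 0)" by (rule disjoint_add_eq_sup)
    also have "\<dots> \<le> sup s 0" using ub[OF a] by (intro sup_least inf.cobounded1 sup.mono) auto
    finally show ?thesis by (simp only: le_diff_eq add.commute)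
  qed
  then have "A *<= (sup s 0 - ?w)" by (auto simp: setle_def)
  then have "s \<le> sup s 0 - ?w" using A(3) by (meson UNIV_I isLub_le_isUb isUbI)
  moreover have "0 \<le> sup s 0 - ?w" by (simp only: diff_ge_0_iff_ge inf.cobounded1)
  ultimately have "sup s 0 \<le> sup s 0 - ?w" by (rule sup_least)
  then have "?w \<le> 0" by (simp only: le_diff_eq add_le_same_cancel1)
  then have w: "?w = 0" using b by (intro order.antisym) auto
  obtain a where a: "a \<in> A" using A by auto
  have "inf (rabs a) b = 0" using A a by auto
  then have "inf (sup s 0 + rabs a) b = 0" using w disjoint_add by blast
  moreover have "rabs s \<le> sup s 0 + rabs a"
  proof -
    have "- s \<le> - a" using ub[OF a] by simp
    also have "- a \<le> rabs a" by (simp add: rabs_def)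
    also have "\<dots> \<le> sup s 0 + rabs a" by (simp add: add_increasing)
    finally have "- s \<le> sup s 0 + rabs a" .
    moreover have "s \<le> sup s 0 + rabs a" using rabs_nonneg[of a] by (intro add_increasing2) simp_all
    ultimately show ?thesis unfolding rabs_def[of s] by (rule sup_least[rotated])
  qed
  ultimately have "inf (rabs s) b = 0" using disjoint_mono[OF _ rabs_nonneg] by blast
  then show "s \<in> ?B" by simp
qed

lemma isLub_SUP:
  fixes f :: "'i \<Rightarrow> 'a::dedekind_riesz"
  assumes "\<And>i. f i \<le> b"
  shows "isLub UNIV (range f) (SUP i. f i)"
proof (rule isLubI2)
  have bdd: "bdd_above (range f)" using assms by (intro bdd_aboveI[where M = b]) auto
  show "isUb UNIV (range f) (SUP i. f i)"
    by (rule isUbI) (auto simp: setle_def intro: cSUP_upper2[OF _ _ order.refl] bdd)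
  show "(SUP i. f i) <=* Collect (isUb UNIV (range f))"
    by (auto simp: setge_def isUb_def setle_def intro!: cSUP_least)
qed

text \<open>The part \<open>w\<close> of \<open>z\<close> below the remainder could be added to each \<open>inf (k z) x\<close>: the result is
  below \<open>inf ((k + 1) z) x\<close> and hence does not exceed the supremum, which forces \<open>w = 0\<close>.\<close>

lemma remainder_disjoint:
  fixes x z :: "'a::dedekind_riesz"
  assumes z: "0 \<le> z" and x: "0 \<le> x"
  shows "inf (x - (SUP k. inf (real k *\<^sub>R z) x)) z = 0" (is "inf (x - ?y) z = 0")
proof (rule order.antisym)
  have ub: "inf (real k *\<^sub>R z) x \<le> ?y" for k
    by (rule cSUP_upper) (auto intro: bdd_aboveI[where M = x])
  let ?w = "inf (x - ?y) z"
  have "inf (real k *\<^sub>R z) x \<le> ?y - ?w" for k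
  proof -
    have "?w + inf (real k *\<^sub>R z) x \<le> inf (real (Suc k) *\<^sub>R z) x"
    proof (rule inf_greatest)
      show "?w + inf (real k *\<^sub>R z) x \<le> real (Suc k) *\<^sub>R z"
        by (simp add: scaleR_add_left add_mono)
      have "?w + inf (real k *\<^sub>R z) x \<le> (x - ?y) + ?y"
        using ub by (intro add_mono) auto
      then show "?w + inf (real k *\<^sub>R z) x \<le> x" by simp
    qed
    also have "\<dots> \<le> ?y" by (rule ub)
    finally show ?thesis by (simp only: le_diff_eq add.commute)
  qed
  then have "?y \<le> ?y - ?w" by (intro cSUP_least) auto
  then show "?w \<le> 0" by (simp only: le_diff_eq add_le_same_cancel1)
  have "?y \<le> x" by (rule cSUP_least) auto
  then show "0 \<le> ?w" using z by simp
qed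

text \<open>The supremum lies in every band that contains \<open>z\<close>.  The remainder is disjoint from \<open>z\<close>, hence
  from the whole generated band, since the elements disjoint from the remainder form a band.  These
  two properties determine the projection, as only \<open>0\<close> is both in a band and disjoint from it.\<close>

lemma band_proj_eq_SUP:
  fixes x z :: "'a::dedekind_riesz"
  assumes z: "0 \<le> z" and x: "0 \<le> x"
  shows "band_proj z x = (SUP k. inf (real k *\<^sub>R z) x)"
proof -
  define y where "y = (SUP k. inf (real k *\<^sub>R z) x)"
  have lub: "isLub UNIV (range (\<lambda>k. inf (real k *\<^sub>R z) x)) y"
    unfolding y_def by (rule isLub_SUP[where b = x]) simp
  have yub: "inf (real k *\<^sub>R z) x \<le> y" for k using isLubD2[OF lub] by blast
  have yle: "y \<le> b" if "\<And>k. inf (real k *\<^sub>R z) x \<le> b" for b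
    unfolding y_def by (rule cSUP_least) (use that in auto)
  have y: "0 \<le> y" "y \<le> x" using yub[of 0] x yle[of x] by (simp_all add: inf.absorb1)
  have inGB: "y \<in> generated_band z"
    unfolding generated_band_def
  proof safe
    fix B assume B: "is_band B" "z \<in> B"
    have "inf (real k *\<^sub>R z) x \<in> B" for k
    proof -
      have "real k *\<^sub>R z \<in> B" using B by (simp add: is_band_def subspace_scale)
      moreover have "rabs (inf (real k *\<^sub>R z) x) \<le> rabs (real k *\<^sub>R z)"
        using z x by (simp add: rabs_of_nonneg scaleR_nonneg_nonneg)
      ultimately show ?thesis using B unfolding is_band_def by blast
    qed
    then have "range (\<lambda>k. inf (real k *\<^sub>R z) x) \<subseteq> B" by auto
    moreover have "\<forall>A s. A \<subseteq> B \<longrightarrow> A \<noteq> {} \<longrightarrow> isLub UNIV A s \<longrightarrow> s \<in> B"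
      using B(1) unfolding is_band_def by simp
    ultimately show "y \<in> B" using lub by blast
  qed
  have "inf (x - y) z = 0"
    unfolding y_def using z x by (rule remainder_disjoint)
  then have "z \<in> {f. inf (rabs f) (x - y) = 0}"
    using z by (simp add: rabs_of_nonneg inf.commute)
  moreover have "is_band {f. inf (rabs f) (x - y) = 0}"
    by (rule is_band_disjoint) (use y in simp)
  ultimately have "generated_band z \<subseteq> {f. inf (rabs f) (x - y) = 0}"
    unfolding generated_band_def by blast
  then have inDC: "x - y \<in> disjoint_complement (generated_band z)"
    using y by (auto simp: disjoint_complement_def rdisjoint_def rabs_of_nonneg inf.commute)
  show ?thesis
    unfolding band_proj_def y_def[symmetric]
  proof (rule the_equality)
    show "y \<in> generated_band z \<and> x - y \<in> disjoint_complement (generated_band z)"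
      using inGB inDC by blast
  next
    fix y' assume y': "y' \<in> generated_band z \<and> x - y' \<in> disjoint_complement (generated_band z)"
    have g: "y - y' \<in> generated_band z"
      using inGB y' unfolding generated_band_def is_band_def by (auto intro: subspace_diff)
    let ?B = "{f. inf (rabs f) (rabs (y - y')) = 0}"
    have "x - y' \<in> ?B" "x - y \<in> ?B"
      using g y' inDC by (auto simp: disjoint_complement_def rdisjoint_def)
    moreover have "subspace ?B" using is_band_disjoint[OF rabs_nonneg] unfolding is_band_def by blast
    ultimately have "(x - y') - (x - y) \<in> ?B" by (metis subspace_diff)
    then have "rabs (y - y') = 0" by simp
    then have "y - y' \<le> 0" "- (y - y') \<le> 0"
      unfolding rabs_def by (metis sup.cobounded1 sup.cobounded2)+
    then show "y' = y" by simp
  qed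
qed

lemma band_proj_ge:
  fixes x z :: "'a::dedekind_riesz"
  assumes "0 \<le> z" "0 \<le> x"
  shows "inf (r *\<^sub>R z) x \<le> band_proj z x"
proof -
  obtain k :: nat where k: "r \<le> real k" using real_arch_simple by blast
  have "inf (r *\<^sub>R z) x \<le> inf (real k *\<^sub>R z) x"
    using k assms by (intro inf_mono scaleR_right_mono) auto
  also have "\<dots> \<le> band_proj z x"
    unfolding band_proj_eq_SUP[OF assms] by (rule cSUP_upper) (auto intro: bdd_aboveI[where M = x])
  finally show ?thesis .
qed

text \<open>The remaining properties of projections and of the complementary components
  \<open>band_proj_d z x\<close>, on which \<open>z\<close> vanishes, are drawn from \<open>band_proj_ge\<close> and this converse.\<close>

lemma band_proj_least:
  fixes x z :: "'a::dedekind_riesz"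
  assumes "0 \<le> z" "0 \<le> x" "\<And>k::nat. inf (real k *\<^sub>R z) x \<le> b"
  shows "band_proj z x \<le> b"
  unfolding band_proj_eq_SUP[OF assms(1,2)] by (rule cSUP_least) (use assms in auto)

lemma band_proj_bounds:
  fixes x z :: "'a::dedekind_riesz"
  assumes "0 \<le> z" "0 \<le> x"
  shows "0 \<le> band_proj z x" "band_proj z x \<le> x"
  using band_proj_ge[OF assms, of 0] band_proj_least[OF assms, of x] assms by (auto simp: inf.absorb1)

text \<open>Taking \<open>a = x\<close> gives maximality of the component \<open>band_proj_d z x\<close>, and taking
  \<open>a = band_proj z x\<close> gives its disjointness from \<open>band_proj z x\<close>.\<close>

lemma disjoint_add_band_proj_le:
  fixes x z :: "'a::dedekind_riesz"
  assumes z: "0 \<le> z" and x: "0 \<le> x" and c: "inf c z = 0" "c \<le> a" and a: "band_proj z x \<le> a"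
  shows "c + band_proj z x \<le> a"
proof -
  have "inf (real k *\<^sub>R z) x \<le> a - c" for k
  proof -
    have "inf (real k *\<^sub>R z) c = 0"
      using c(1) disjoint_scaleR[of z c] by (simp add: inf.commute)
    then have "inf (inf (real k *\<^sub>R z) x) c = 0"
      using disjoint_mono z x by (metis inf.boundedI inf.cobounded1 of_nat_0_le_iff scaleR_nonneg_nonneg)
    then have "inf (real k *\<^sub>R z) x + c = sup (inf (real k *\<^sub>R z) x) c"
      by (rule disjoint_add_eq_sup)
    also have "\<dots> \<le> a" using c(2) order.trans[OF band_proj_ge[OF z x] a] by simp
    finally show ?thesis by (simp add: le_diff_eq)
  qed
  then have "band_proj z x \<le> a - c" by (rule band_proj_least[OF z x])
  then show ?thesis by (simp only: le_diff_eq add.commute)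
qed

lemma band_proj_d_bounds:
  fixes x z :: "'a::dedekind_riesz"
  assumes "0 \<le> z" "0 \<le> x"
  shows "0 \<le> band_proj_d z x" "band_proj_d z x \<le> x"
  using band_proj_bounds[OF assms] by (auto simp: band_proj_d_def)

lemma band_proj_d_disjoint:
  fixes x z :: "'a::dedekind_riesz"
  assumes "0 \<le> z" "0 \<le> x"
  shows "inf (band_proj_d z x) z = 0"
  using remainder_disjoint[OF assms] by (simp add: band_proj_d_def band_proj_eq_SUP[OF assms])

lemma band_proj_d_greatest:
  fixes x z :: "'a::dedekind_riesz"
  assumes "0 \<le> z" "0 \<le> x" "inf c z = 0" "c \<le> x"
  shows "c \<le> band_proj_d z x"
  using disjoint_add_band_proj_le[OF assms band_proj_bounds(2)[OF assms(1,2)]]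
  by (simp add: band_proj_d_def le_diff_eq)

lemma band_proj_d_component:
  fixes x z :: "'a::dedekind_riesz"
  assumes "0 \<le> z" "0 \<le> x"
  shows "inf (band_proj_d z x) (x - band_proj_d z x) = 0"
proof (rule order.antisym)
  let ?c = "inf (band_proj_d z x) (band_proj z x)"
  have c: "0 \<le> ?c" using band_proj_bounds[OF assms] band_proj_d_bounds[OF assms] by simp
  have "inf ?c z = 0"
    by (rule disjoint_mono[OF band_proj_d_disjoint[OF assms] c inf.cobounded1])
  then have "?c + band_proj z x \<le> band_proj z x"
    by (intro disjoint_add_band_proj_le[OF assms]) auto
  then show "inf (band_proj_d z x) (x - band_proj_d z x) \<le> 0" by (simp add: band_proj_d_def)
  show "0 \<le> inf (band_proj_d z x) (x - band_proj_d z x)" using c by (simp add: band_proj_d_def)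
qed

text \<open>The component on which \<open>z = 0\<close> is the infimum of these truncations as \<open>r\<close> grows.  A bound by
  a single truncation compares components with linear expressions in \<open>z\<close>.\<close>

lemma band_proj_d_le_truncation:
  fixes x z :: "'a::dedekind_riesz"
  assumes "0 \<le> z" "0 \<le> x"
  shows "band_proj_d z x \<le> sup 0 (x - r *\<^sub>R z)"
proof -
  have "band_proj_d z x \<le> x - inf (r *\<^sub>R z) x"
    unfolding band_proj_d_def using band_proj_ge[OF assms] by (rule diff_left_mono)
  also have "\<dots> = x + sup (- (r *\<^sub>R z)) (- x)"
    by (simp add: neg_inf_eq_sup diff_conv_add_uminus del: add_uminus_conv_diff)
  also have "\<dots> = sup (x - r *\<^sub>R z) 0" by (simp add: add_sup_distrib_left)
  finally show ?thesis by (simp add: sup.commute)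
qed


section \<open>The exponential in a space of extended real valued continuous functions\<close>

text \<open>The continuous extension of \<open>exp\<close> to the extended reals.  Composing it with a function in
  \<open>C\<^sup>\<infinity>(K)\<close> yields a continuous function that is finite wherever the original one is, so the
  exponential of an element exists without extending any function from a dense subset.\<close>

definition ereal_exp :: "ereal \<Rightarrow> ereal" where
  "ereal_exp y = (if y = \<infinity> then \<infinity> else if y = - \<infinity> then 0 else ereal (exp (real_of_ereal y)))"

lemma ereal_exp_simps [simp]:
  "ereal_exp (ereal t) = ereal (exp t)" "ereal_exp \<infinity> = \<infinity>" "ereal_exp (- \<infinity>) = 0"
  by (simp_all add: ereal_exp_def)

lemma ereal_exp_nonneg: "0 \<le> ereal_exp y"
  by (cases y) auto

lemma ereal_exp_mono: "y \<le> z \<Longrightarrow> ereal_exp y \<le> ereal_exp z"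
  by (cases y; cases z) auto

text \<open>By monotonicity it suffices that a strict bound for the value at \<open>y\<close> persists at some point
  on the relevant side of \<open>y\<close>; logarithms provide such points.\<close>

lemma continuous_ereal_exp: "continuous_on UNIV ereal_exp"
  unfolding continuous_on_def
proof (intro ballI order_tendstoI)
  fix y c :: ereal
  assume c: "c < ereal_exp y"
  show "\<forall>\<^sub>F z in at y within UNIV. c < ereal_exp z"
  proof (cases "c < 0")
    case True
    then have "c < ereal_exp z" for z using ereal_exp_nonneg order.strict_trans2 by blast
    then show ?thesis by simp
  next
    case False
    then obtain r where r: "c = ereal r" "0 \<le> r" using c by (cases c) auto
    have "\<exists>x<y. c < ereal_exp x"
    proof (cases y)
      case (real t)
      then have "r < exp t" using c r by simp
      then obtain q where q: "r < q" "q < exp t" using dense by blast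
      then have "ln q < ln (exp t)" using r by (subst ln_less_cancel_iff) auto
      then show ?thesis using real q r by (intro exI[of _ "ereal (ln q)"]) auto
    next
      case PInf
      then show ?thesis using r by (intro exI[of _ "ereal (ln (r + 1))"]) auto
    next
      case MInf
      then show ?thesis using c r by simp
    qed
    then obtain x where x: "x < y" "c < ereal_exp x" by blast
    have "\<forall>\<^sub>F z in at y within UNIV. x < z"
      using order_tendstoD(1)[OF tendsto_ident_at x(1)] .
    then show ?thesis
      by eventually_elim (rule order.strict_trans2[OF x(2) ereal_exp_mono[OF less_imp_le]])
  qed
next
  fix y c :: ereal
  assume c: "ereal_exp y < c"
  have "\<exists>x>y. ereal_exp x < c"
  proof (cases c)
    case (real r)
    show ?thesis
    proof (cases y)
      case t: (real t)
      then have "exp t < r" using c real by simp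
      then obtain q where q: "exp t < q" "q < r" using dense by blast
      have "0 < q" using q(1) exp_gt_zero[of t] by linarith
      moreover have "ln (exp t) < ln q" using q \<open>0 < q\<close> by (subst ln_less_cancel_iff) auto
      ultimately show ?thesis using real q t by (intro exI[of _ "ereal (ln q)"]) auto
    next
      case PInf
      then show ?thesis using c by simp
    next
      case MInf
      then have "0 < r" using c real by simp
      then show ?thesis using real MInf by (intro exI[of _ "ereal (ln (r / 2))"]) auto
    qed
  next
    case PInf
    have "y < \<infinity>" using c by (cases y) auto
    then obtain x where "y < x" "x < \<infinity>" using dense by blast
    moreover from this have "ereal_exp x < \<infinity>" by (cases x) auto
    ultimately show ?thesis using PInf by auto
  next
    case MInf
    then show ?thesis using c by simp
  qed
  then obtain x where x: "y < x" "ereal_exp x < c" by blast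
  have "\<forall>\<^sub>F z in at y within UNIV. z < x"
    using order_tendstoD(2)[OF tendsto_ident_at x(1)] .
  then show "\<forall>\<^sub>F z in at y within UNIV. ereal_exp z < c"
    by eventually_elim (rule order.strict_trans1[OF ereal_exp_mono[OF less_imp_le] x(2)])
qed

lemma closedin_Collect_le:
  fixes f g :: "'k \<Rightarrow> 'b::{linorder_topology, dense_order}"
  assumes "continuous_map K euclidean f" "continuous_map K euclidean g"
  shows "closedin K {k \<in> topspace K. f k \<le> g k}"
proof -
  have "openin K {k \<in> topspace K. f k \<in> {c<..}}" "openin K {k \<in> topspace K. g k \<in> {..<c}}" for c
    by (rule openin_continuous_map_preimage[OF assms(1)] openin_continuous_map_preimage[OF assms(2)];
        simp)+
  moreover have between: "f k \<le> g k \<longleftrightarrow> \<not> (\<exists>c. g k < c \<and> c < f k)" for k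
    by (metis dense not_le order.strict_trans)
  ultimately have "openin K (\<Union>c. {k \<in> topspace K. f k \<in> {c<..}} \<inter> {k \<in> topspace K. g k \<in> {..<c}})"
    by (intro openin_Union) auto
  also have "(\<Union>c. {k \<in> topspace K. f k \<in> {c<..}} \<inter> {k \<in> topspace K. g k \<in> {..<c}}) =
      topspace K - {k \<in> topspace K. f k \<le> g k}"
    unfolding between by auto
  finally show ?thesis unfolding closedin_def by auto
qed

text \<open>The points where \<open>\<Phi> v\<close> is finite are dense and the inequality is a closed condition.  All
  comparisons can therefore be made where one fixed element is finite, and there the linear
  operations are pointwise.\<close>

lemma C_infinity_le_from_dense:
  assumes rep: "C_infinity_representation w K \<Phi>"
    and le: "\<And>k. k \<in> topspace K \<Longrightarrow> \<bar>\<Phi> v k\<bar> \<noteq> \<infinity> \<Longrightarrow> \<Phi> a k \<le> \<Phi> b k"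
  shows "a \<le> b"
proof -
  have C: "\<Phi> u \<in> C_infinity K" for u
    using rep unfolding C_infinity_representation_def by (meson UNIV_I bij_betwE)
  have "K closure_of {k \<in> topspace K. \<bar>\<Phi> v k\<bar> \<noteq> \<infinity>} \<subseteq> {k \<in> topspace K. \<Phi> a k \<le> \<Phi> b k}"
    by (rule closure_of_minimal)
      (use le C in \<open>auto simp: C_infinity_def intro!: closedin_Collect_le\<close>)
  then have "\<forall>k\<in>topspace K. \<Phi> a k \<le> \<Phi> b k" using C[of v] by (auto simp: C_infinity_def)
  then show ?thesis using rep unfolding C_infinity_representation_def by blast
qed

lemma functional_calculus_exp:
  assumes rep: "C_infinity_representation w K \<Phi>" and k: "k \<in> topspace K"
    and t: "\<Phi> v k = ereal t"
  shows "\<Phi> (functional_calculus K \<Phi> exp v) k = ereal (exp t)"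
proof -
  have C: "\<Phi> u \<in> C_infinity K" for u
    using rep unfolding C_infinity_representation_def by (meson UNIV_I bij_betwE)
  define f where "f = restrict (\<lambda>k. ereal_exp (\<Phi> v k)) (topspace K)"
  let ?F = "\<lambda>h. {k \<in> topspace K. \<bar>h k\<bar> \<noteq> \<infinity>}"
  have "continuous_map K euclidean (ereal_exp \<circ> \<Phi> v)"
    by (rule continuous_map_compose[of _ euclidean])
      (use C[of v] continuous_ereal_exp in \<open>auto simp: C_infinity_def\<close>)
  then have "continuous_map K euclidean f"
    by (rule continuous_map_eq) (simp add: f_def)
  moreover have "?F (\<Phi> v) \<subseteq> ?F f" by (auto simp: f_def)
  then have "K closure_of ?F f = topspace K"
    using C[of v] closure_of_mono[of "?F (\<Phi> v)" "?F f" K] closure_of_subset_topspace[of K "?F f"]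
    by (auto simp: C_infinity_def)
  ultimately have "f \<in> C_infinity K" by (simp add: C_infinity_def f_def)
  then obtain y where y: "\<Phi> y = f"
    using rep unfolding C_infinity_representation_def by (metis bij_betw_imp_surj_on imageE)
  have "functional_calculus K \<Phi> exp v = y"
    unfolding functional_calculus_def
  proof (rule the_equality)
    show y': "\<forall>k\<in>topspace K. \<forall>t. \<Phi> v k = ereal t \<longrightarrow> \<Phi> y k = ereal (exp t)"
      by (simp add: y f_def)
    fix z assume z: "\<forall>k\<in>topspace K. \<forall>t. \<Phi> v k = ereal t \<longrightarrow> \<Phi> z k = ereal (exp t)"
    have eq: "\<Phi> z k = \<Phi> y k" if "k \<in> topspace K" "\<bar>\<Phi> v k\<bar> \<noteq> \<infinity>" for k
      using that y' z by (cases "\<Phi> v k") auto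
    show "z = y"
      by (rule order.antisym; rule C_infinity_le_from_dense[OF rep, of v]) (simp_all add: eq)
  qed
  then show ?thesis using k t by (simp add: y f_def)
qed

text \<open>This is \<open>1 + c + t \<le> exp (c + t)\<close>, read at every point where \<open>v\<close> has a finite value \<open>t\<close>.\<close>

lemma functional_calculus_exp_ge:
  assumes rep: "C_infinity_representation w K \<Phi>"
  shows "(1 + c) *\<^sub>R w + v \<le> exp c *\<^sub>R functional_calculus K \<Phi> exp v"
proof (rule C_infinity_le_from_dense[OF rep, of v])
  fix k assume k: "k \<in> topspace K" "\<bar>\<Phi> v k\<bar> \<noteq> \<infinity>"
  then obtain t where t: "\<Phi> v k = ereal t" by auto
  have add: "\<Phi> (a + b) k = ereal (r + s)" if "\<Phi> a k = ereal r" "\<Phi> b k = ereal s" for a b r s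
    using rep k(1) that unfolding C_infinity_representation_def by blast
  have scale: "\<Phi> (r *\<^sub>R a) k = ereal (r * s)" if "\<Phi> a k = ereal s" for a r s
    using rep k(1) that unfolding C_infinity_representation_def by blast
  have "\<Phi> w k = ereal 1"
    using rep k(1) unfolding C_infinity_representation_def by (simp add: one_ereal_def)
  then have "\<Phi> ((1 + c) *\<^sub>R w + v) k = ereal ((1 + c) * 1 + t)"
    by (intro add scale t)
  moreover have "\<Phi> (exp c *\<^sub>R functional_calculus K \<Phi> exp v) k = ereal (exp c * exp t)"
    by (intro scale functional_calculus_exp[OF rep k(1) t])
  moreover have "(1 + c) * 1 + t \<le> exp c * exp t"
    using exp_ge_add_one_self[of "c + t"] by (simp add: exp_add)
  ultimately show "\<Phi> ((1 + c) *\<^sub>R w + v) k \<le> \<Phi> (exp c *\<^sub>R functional_calculus K \<Phi> exp v) k"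
    by simp
qed

lemma functional_calculus_exp_nonneg:
  assumes rep: "C_infinity_representation w K \<Phi>"
  shows "0 \<le> functional_calculus K \<Phi> exp v"
proof (rule C_infinity_le_from_dense[OF rep, of v])
  fix k assume k: "k \<in> topspace K" "\<bar>\<Phi> v k\<bar> \<noteq> \<infinity>"
  then obtain t where t: "\<Phi> v k = ereal t" by auto
  have "\<Phi> w k = ereal 1"
    using rep k(1) unfolding C_infinity_representation_def by (simp add: one_ereal_def)
  moreover have "\<forall>r u. \<forall>k\<in>topspace K. \<forall>a. \<Phi> u k = ereal a \<longrightarrow> \<Phi> (r *\<^sub>R u) k = ereal (r * a)"
    using rep unfolding C_infinity_representation_def by simp
  ultimately have "\<Phi> (0 *\<^sub>R w) k = ereal (0 * 1)" using k(1) by blast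
  then have "\<Phi> 0 k = 0" by (simp add: zero_ereal_def)
  then show "\<Phi> 0 k \<le> \<Phi> (functional_calculus K \<Phi> exp v) k"
    by (simp add: functional_calculus_exp[OF rep k(1) t])
qed

section \<open>Products in the universal completion and the sup-completion\<close>

lemma f_algebra_disjoint_mult:
  fixes a b :: "'u::dedekind_f_algebra"
  assumes "inf a b = 0"
  shows "b * a = 0"
proof -
  have "0 \<le> a" "0 \<le> b" using assms by (metis inf.cobounded1 inf.cobounded2)+
  then have "inf b (b * a) = 0" using f_disjoint_left[OF assms] by (simp add: inf.commute)
  then have "inf (b * a) (b * a) = 0" using \<open>0 \<le> a\<close> by (rule f_disjoint_right)
  then show ?thesis by simp
qed

lemma universal_completion_le_iff:
  assumes "universal_completion e \<iota>"
  shows "\<iota> a \<le> \<iota> b \<longleftrightarrow> a \<le> b"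
  using assms unfolding universal_completion_def by (metis injD sup.absorb_iff2)

text \<open>The element \<open>a = inf q b\<close> is disjoint from \<open>e - q\<close>, so \<open>(e - q) a = 0\<close>, i.e. \<open>a = q a\<close>.  Both
  factors may then be enlarged, \<open>q\<close> to \<open>v\<close> and \<open>a\<close> to \<open>b\<close>.\<close>

lemma component_inf_le_mult:
  assumes uc: "universal_completion e \<iota>"
    and q: "inf q (e - q) = 0" and b: "0 \<le> b" and v: "\<iota> q \<le> v"
  shows "\<iota> (inf q b) \<le> v * \<iota> b"
proof -
  have lin: "linear \<iota>" and inf: "\<iota> (inf a c) = inf (\<iota> a) (\<iota> c)" and one: "\<iota> e * y = y" for a c y
    using uc unfolding universal_completion_def by auto
  let ?a = "inf q b"
  have pos: "0 \<le> \<iota> a" if "0 \<le> a" for a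
    using universal_completion_le_iff[OF uc, of 0 a] that linear_0[OF lin] by simp
  have q0: "0 \<le> q" using q by (metis inf.cobounded1)
  have "inf ?a (e - q) = 0" using disjoint_mono[OF q, of ?a] q0 b by simp
  then have "\<iota> (e - q) * \<iota> ?a = 0"
    using f_algebra_disjoint_mult inf linear_0[OF lin] by metis
  then have "\<iota> ?a = \<iota> q * \<iota> ?a" using one by (simp add: linear_diff[OF lin] left_diff_distrib)
  also have "\<dots> \<le> \<iota> q * \<iota> b"
  proof -
    have "0 \<le> \<iota> q * (\<iota> (b - ?a))" by (intro f_mult_nonneg pos q0) (simp only: diff_ge_0_iff_ge inf.cobounded2)
    then show ?thesis by (simp only: linear_diff[OF lin] right_diff_distrib diff_ge_0_iff_ge)
  qed
  also have "\<dots> \<le> v * \<iota> b"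
  proof -
    have "0 \<le> (v - \<iota> q) * \<iota> b" by (intro f_mult_nonneg pos b) (use v in simp)
    then show ?thesis by (simp add: left_diff_distrib)
  qed
  finally show ?thesis .
qed

lemma univ_to_sup_mono:
  assumes "\<iota> 0 \<le> v" "v \<le> w"
  shows "univ_to_sup \<iota> \<kappa> v \<le> univ_to_sup \<iota> \<kappa> w"
  unfolding univ_to_sup_def
  by (rule cSup_subset_mono) (use assms in \<open>auto intro!: bdd_aboveI[where M = top]\<close>)

lemma univ_to_sup_embedding:
  assumes "universal_completion e \<iota>" "sup_completion \<kappa>" "0 \<le> a"
  shows "univ_to_sup \<iota> \<kappa> (\<iota> a) = \<kappa> a"
  unfolding univ_to_sup_def
  by (rule cSup_eq_maximum)
    (use assms universal_completion_le_iff[OF assms(1)] in \<open>auto simp: sup_completion_def\<close>)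

lemma univ_to_sup_mult_le:
  fixes \<kappa> :: "'a::dedekind_riesz \<Rightarrow> 's::sup_cone"
  assumes "0 \<le> v" "0 \<le> w" "univ_to_sup \<iota> \<kappa> v \<le> y" "univ_to_sup \<iota> \<kappa> w \<le> z"
  shows "univ_to_sup \<iota> \<kappa> (v * w) \<le> sup_mult \<iota> \<kappa> y z"
  unfolding sup_mult_def
  by (rule cSup_upper) (use assms in \<open>auto intro!: bdd_aboveI[where M = top]\<close>)

lemma sup_completion_sum:
  assumes \<kappa>: "sup_completion \<kappa>" and "\<And>i. i \<in> I \<Longrightarrow> 0 \<le> r i"
  shows "\<kappa> (\<Sum>i\<in>I. r i *\<^sub>R f i) = (\<Sum>i\<in>I. r i *\<^sub>R \<kappa> (f i))"
proof -
  have add: "\<kappa> (a + b) = \<kappa> a + \<kappa> b" and scale: "0 \<le> t \<Longrightarrow> \<kappa> (t *\<^sub>R a) = t *\<^sub>R \<kappa> a" for a b t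
    using \<kappa> unfolding sup_completion_def by auto
  have zero: "\<kappa> 0 = 0" using scale[of 0 0] by (simp add: cone_scale_zero)
  show ?thesis
    using assms(2) by (induction I rule: infinite_finite_induct) (auto simp: zero add scale)
qed

lemma partial_sum_le_generating_function:
  fixes \<kappa> :: "'a::dedekind_riesz \<Rightarrow> 's::sup_cone"
  assumes "sup_completion \<kappa>" "0 \<le> s"
  shows "\<kappa> (\<Sum>n\<le>N. s ^ n *\<^sub>R mass_function e T x (real n)) \<le> generating_function \<kappa> e T x s"
  unfolding generating_function_def
  by (subst sup_completion_sum[OF assms(1)])
    (use assms(2) in \<open>auto intro!: cSUP_upper bdd_aboveI[where M = top]\<close>)

section \<open>Chernoff bounds\<close>

text \<open>The common part of both bounds.  With \<open>D\<^sub>N = d\<^sub>0 + \<dots> + d\<^sub>N \<le> e\<close>, the elements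
  \<open>T (inf p D\<^sub>N)\<close> are bounded termwise.  The rest of \<open>T p\<close> is at most \<open>e - T D\<^sub>N\<close>, and
  naturality of \<open>x\<close> makes the infimum of these \<open>0\<close>.\<close>

lemma natural_tail_bound:
  fixes e x p :: "'a::dedekind_riesz" and \<iota> :: "'a \<Rightarrow> 'u::dedekind_f_algebra"
    and \<kappa> :: "'a \<Rightarrow> 's::sup_cone"
  assumes T: "conditional_riesz_triple e T" and uc: "universal_completion e \<iota>"
    and sc: "sup_completion \<kappa>" and nat: "natural_element e T x"
    and s: "0 < s" and p: "0 \<le> p" "p \<le> e" and v: "0 \<le> v"
    and q: "\<And>n. inf (q n) (e - q n) = 0"
    and Tq: "\<And>n. T (q n) \<le> q n"
    and qv: "\<And>n. \<iota> (q n) \<le> s ^ n *\<^sub>R v"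
    and pq: "\<And>n. inf p (proj_eq x (real n *\<^sub>R e) e) \<le> q n"
  shows "\<kappa> (T p) \<le> sup_mult \<iota> \<kappa> (univ_to_sup \<iota> \<kappa> v) (generating_function \<kappa> e T x s)"
    (is "_ \<le> ?rhs")
proof -
  have e: "0 \<le> e" and linT: "linear T" and Tpos: "0 \<le> f \<Longrightarrow> 0 \<le> T f" for f
    using T unfolding conditional_riesz_triple_def weak_order_unit_def by auto
  have Tmono: "T f \<le> T g" if "f \<le> g" for f g
    using Tpos[of "g - f"] that by (simp add: linear_diff[OF linT])
  have lin\<iota>: "linear \<iota>" using uc unfolding universal_completion_def by simp
  have \<iota>0: "\<iota> 0 = 0" by (rule linear_0[OF lin\<iota>])
  have \<iota>pos: "0 \<le> \<iota> a" if "0 \<le> a" for a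
    using universal_completion_le_iff[OF uc, of 0 a] that \<iota>0 by simp
  have \<kappa>le: "\<kappa> a \<le> \<kappa> b \<longleftrightarrow> a \<le> b" for a b
    using sc unfolding sup_completion_def by simp
  have \<kappa>down: "\<forall>y a. y \<le> \<kappa> a \<longrightarrow> y \<in> range \<kappa>"
    using sc unfolding sup_completion_def by (elim conjE)
  define d where "d n = proj_eq x (real n *\<^sub>R e) e" for n
  define D where "D N = (\<Sum>n\<le>N. d n)" for N
  have mass: "mass_function e T x (real n) = T (d n)" for n
    by (simp add: mass_function_def d_def)
  have d: "0 \<le> d n" "d n \<le> e" "inf (d n) (rabs (x - real n *\<^sub>R e)) = 0" for n
    unfolding d_def proj_eq_def
    by (auto intro!: band_proj_d_bounds band_proj_d_disjoint rabs_nonneg e)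
  (* x cannot be close to both n e and m e: the two distances add up to at least |n - m| e. *)
  have disj: "inf (d n) (d m) = 0" if "n \<noteq> m" for n m
  proof -
    let ?f = "inf (d n) (d m)" and ?r = "\<bar>real n - real m\<bar>"
    have f: "0 \<le> ?f" using d by simp
    have "inf ?f (rabs (x - real n *\<^sub>R e)) = 0" "inf ?f (rabs (x - real m *\<^sub>R e)) = 0"
      using f d(3) disjoint_mono by (metis inf.cobounded1, metis inf.cobounded2)
    then have *: "inf (rabs (x - real n *\<^sub>R e) + rabs (x - real m *\<^sub>R e)) ?f = 0"
      by (intro disjoint_add) (simp_all add: inf.commute)
    have "?r *\<^sub>R e \<le> rabs ((real n - real m) *\<^sub>R e)"
      by (cases "real n \<ge> real m") (auto simp: rabs_def scaleR_left_diff_distrib)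
    also have "(real n - real m) *\<^sub>R e = (real n *\<^sub>R e - x) + (x - real m *\<^sub>R e)"
      by (simp add: scaleR_left_diff_distrib)
    also have "rabs \<dots> \<le> rabs (real n *\<^sub>R e - x) + rabs (x - real m *\<^sub>R e)" by (rule rabs_add_le)
    finally have "inf (?r *\<^sub>R e) ?f = 0"
      using disjoint_mono[OF *] e by (simp add: rabs_minus_commute scaleR_nonneg_nonneg)
    then have "inf (inverse ?r *\<^sub>R (?r *\<^sub>R e)) ?f = 0" by (rule disjoint_scaleR) simp
    then have "inf e ?f = 0" using that by simp
    moreover have "?f \<le> e" using d by (simp add: le_infI1)
    ultimately show ?thesis by (simp add: inf.absorb2)
  qed
  have De: "D N \<le> e" for N
    unfolding D_def by (rule disjoint_sum_le) (use d e disj in auto)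
  have bound: "\<kappa> (T (inf p (D N))) \<le> ?rhs" for N
  proof -
    let ?w = "\<Sum>n\<le>N. s ^ n *\<^sub>R T (d n)"
    have TpD: "0 \<le> T (inf p (D N))"
      unfolding D_def by (intro Tpos inf_greatest p sum_nonneg d)
    have w: "0 \<le> ?w" using d s Tpos by (intro sum_nonneg scaleR_nonneg_nonneg) auto
    have "T (inf p (D N)) \<le> T (\<Sum>n\<le>N. inf p (d n))"
      unfolding D_def by (intro Tmono inf_sum_le) (use d p in auto)
    also have "\<dots> = (\<Sum>n\<le>N. T (inf p (d n)))" by (rule linear_sum[OF linT])
    also have "\<dots> \<le> (\<Sum>n\<le>N. inf (q n) (T (d n)))"
    proof (intro sum_mono inf_greatest)
      fix n
      show "T (inf p (d n)) \<le> q n"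
        using Tmono[OF pq[of n]] Tq[of n] unfolding d_def by (rule order.trans)
      show "T (inf p (d n)) \<le> T (d n)" by (rule Tmono) simp
    qed
    finally have "\<iota> (T (inf p (D N))) \<le> \<iota> (\<Sum>n\<le>N. inf (q n) (T (d n)))"
      by (simp add: universal_completion_le_iff[OF uc])
    also have "\<dots> = (\<Sum>n\<le>N. \<iota> (inf (q n) (T (d n))))" by (rule linear_sum[OF lin\<iota>])
    also have "\<dots> \<le> (\<Sum>n\<le>N. (s ^ n *\<^sub>R v) * \<iota> (T (d n)))"
      by (intro sum_mono component_inf_le_mult[OF uc q] qv Tpos d)
    also have "\<dots> = v * \<iota> ?w"
      by (simp add: linear_sum[OF lin\<iota>] linear_scale[OF lin\<iota>] sum_distrib_left)
    finally have "univ_to_sup \<iota> \<kappa> (\<iota> (T (inf p (D N)))) \<le> univ_to_sup \<iota> \<kappa> (v * \<iota> ?w)"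
      using \<iota>pos[OF TpD] by (intro univ_to_sup_mono) (simp_all add: \<iota>0)
    also have "\<dots> \<le> ?rhs"
    proof (rule univ_to_sup_mult_le)
      show "univ_to_sup \<iota> \<kappa> (\<iota> ?w) \<le> generating_function \<kappa> e T x s"
        using partial_sum_le_generating_function[OF sc, of s e T x N] s
        by (simp add: univ_to_sup_embedding[OF uc sc w] mass)
    qed (rule v, rule \<iota>pos[OF w], rule order.refl)
    finally show ?thesis unfolding univ_to_sup_embedding[OF uc sc TpD] .
  qed
  (* Order limits are to be taken in E; cutting the right-hand side down to T p moves it there,
     since the image of E is downward closed in the sup-completion. *)
  obtain z where z: "inf ?rhs (\<kappa> (T p)) = \<kappa> z"
    using \<kappa>down inf.cobounded2[of ?rhs "\<kappa> (T p)"] by blast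
  have zN: "T (inf p (D N)) \<le> z" for N
  proof -
    have "\<kappa> (T (inf p (D N))) \<le> \<kappa> (T p)" unfolding \<kappa>le by (rule Tmono) simp
    then have "\<kappa> (T (inf p (D N))) \<le> \<kappa> z" unfolding z[symmetric] using bound by (rule inf_greatest[rotated])
    then show ?thesis by (simp add: \<kappa>le)
  qed
  have "(\<Sum>n\<le>N. mass_function e T x (real n)) \<le> e - (T p - z)" for N
  proof -
    have "p + D N = inf p (D N) + sup p (D N)"
      by (rule trans[OF add_eq_inf_sup]) (simp only: add.commute)
    also have "\<dots> \<le> inf p (D N) + e" using p De by (intro add_left_mono) simp
    finally have "T (p + D N) \<le> T (inf p (D N) + e)" by (rule Tmono)
    also have "\<dots> = T (inf p (D N)) + e"
      using T unfolding conditional_riesz_triple_def by (simp add: linear_add[OF linT])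
    also have "\<dots> \<le> z + e" using zN by (rule add_right_mono)
    finally have "T p + T (D N) \<le> z + e" by (simp add: linear_add[OF linT])
    moreover have "T (D N) = (\<Sum>n\<le>N. mass_function e T x (real n))"
      unfolding D_def mass by (rule linear_sum[OF linT])
    ultimately have "(\<Sum>n\<le>N. mass_function e T x (real n)) + T p \<le> e + z"
      by (simp only: add.commute)
    then have "(\<Sum>n\<le>N. mass_function e T x (real n)) \<le> (e + z) - T p" by (simp only: le_diff_eq)
    then show ?thesis by (simp only: diff_diff_eq2)
  qed
  then have "isUb UNIV (range (\<lambda>N. \<Sum>n\<le>N. mass_function e T x (real n))) (e - (T p - z))"
    by (intro isUb_UNIV_I) auto
  then have "e \<le> e - (T p - z)"
    using nat unfolding natural_element_def by (rule isLub_le_isUb[rotated])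
  then have "T p - z \<le> 0" by (simp only: le_diff_eq add_le_same_cancel1)
  then have "T p \<le> z" by (simp only: diff_le_0_iff_le)
  then have "\<kappa> (T p) \<le> inf ?rhs (\<kappa> (T p))" unfolding z by (simp only: \<kappa>le)
  then show ?thesis by (rule order.trans) (rule inf.cobounded1)
qed

text \<open>Every \<open>inf (k z) e\<close> is fixed by \<open>T\<close> and lies below \<open>band_proj z e\<close>, hence below its
  expectation; the supremum over \<open>k\<close> gives \<open>band_proj z e \<le> T (band_proj z e)\<close>.\<close>

lemma conditional_expectation_band_proj_d_le:
  fixes e z :: "'a::dedekind_riesz"
  assumes T: "conditional_riesz_triple e T" and z: "0 \<le> z" "z \<in> range T"
  shows "T (band_proj_d z e) \<le> band_proj_d z e"
proof -
  have e: "0 \<le> e" and linT: "linear T" and Tpos: "0 \<le> f \<Longrightarrow> 0 \<le> T f" and Te: "T e = e"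
    and TT: "T (T f) = T f" and R: "dedekind_complete_riesz_subspace (range T)" for f
    using T unfolding conditional_riesz_triple_def weak_order_unit_def by auto
  have "inf (real k *\<^sub>R z) e \<le> T (band_proj z e)" for k
  proof -
    have "real k *\<^sub>R z \<in> range T" "e \<in> range T"
      using R z(2) rangeI[of T e] unfolding dedekind_complete_riesz_subspace_def Te
      by (auto simp: subspace_scale)
    then have "inf (real k *\<^sub>R z) e \<in> range T"
      using R unfolding dedekind_complete_riesz_subspace_def by blast
    then have "T (inf (real k *\<^sub>R z) e) = inf (real k *\<^sub>R z) e" using TT by auto
    moreover have "0 \<le> T (band_proj z e - inf (real k *\<^sub>R z) e)"
      using band_proj_ge[OF z(1) e] by (intro Tpos) (simp only: diff_ge_0_iff_ge)
    ultimately show ?thesis by (simp only: linear_diff[OF linT] le_diff_eq) simp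
  qed
  then have "band_proj z e \<le> T (band_proj z e)" by (rule band_proj_least[OF z(1) e])
  then show ?thesis by (simp add: band_proj_d_def linear_diff[OF linT] Te)
qed

text \<open>Here \<open>\<sigma>\<close> is the sign of \<open>ln s\<close> and \<open>r\<close> its absolute value, so that the cases \<open>s > 1\<close> and
  \<open>s < 1\<close> are treated at once: the component on the left is \<open>P\<^bsub>x \<ge> u\<^esub> e\<close> for \<open>\<sigma> = 1\<close> and
  \<open>P\<^bsub>x \<le> u\<^esub> e\<close> for \<open>\<sigma> = -1\<close>.  The comparison component \<open>q\<^sub>n\<close> is the complementary
  component of \<open>(\<sigma> (u - n e))\<^sup>+\<close>.\<close>

lemma tail_bound_exponential:
  fixes e x p y :: "'a::dedekind_riesz" and \<iota> :: "'a \<Rightarrow> 'u::dedekind_f_algebra"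
    and \<kappa> :: "'a \<Rightarrow> 's::sup_cone"
  assumes T: "conditional_riesz_triple e T" and uc: "universal_completion e \<iota>"
    and rep: "C_infinity_representation (\<iota> e) K \<Phi>"
    and sc: "sup_completion \<kappa>" and nat: "natural_element e T x" and u: "u \<in> range T"
    and s: "0 < s" and r: "0 \<le> r" and \<sigma>: "ln s = r * \<sigma>" "\<bar>\<sigma>\<bar> = 1"
  shows "\<kappa> (T (band_proj_d (rpos (\<sigma> *\<^sub>R (u - x))) e)) \<le>
    sup_mult \<iota> \<kappa> (univ_to_sup \<iota> \<kappa> (riesz_power K \<Phi> \<iota> s (- u))) (generating_function \<kappa> e T x s)"
proof -
  have e: "0 \<le> e" and Te: "T e = e" and R: "dedekind_complete_riesz_subspace (range T)"
    using T unfolding conditional_riesz_triple_def weak_order_unit_def by auto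
  have lin\<iota>: "linear \<iota>" and \<iota>sup: "\<iota> (sup a b) = sup (\<iota> a) (\<iota> b)" for a b
    using uc unfolding universal_completion_def by auto
  let ?z = "rpos (\<sigma> *\<^sub>R (u - x))"
  define y where "y n = rpos (\<sigma> *\<^sub>R (u - real n *\<^sub>R e))" for n :: nat
  have y: "0 \<le> y n" and z: "0 \<le> ?z" for n by (simp_all add: y_def rpos_def)
  let ?v = "riesz_power K \<Phi> \<iota> s (- u)"
  have v: "0 \<le> ?v" unfolding riesz_power_def by (rule functional_calculus_exp_nonneg[OF rep])
  show ?thesis
  proof (rule natural_tail_bound[where q = "\<lambda>n. band_proj_d (y n) e", OF T uc sc nat s _ _ v])
    fix n
    show "inf (band_proj_d (y n) e) (e - band_proj_d (y n) e) = 0"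
      by (rule band_proj_d_component[OF y e])
    have sub: "subspace (range T)" using R unfolding dedekind_complete_riesz_subspace_def by simp
    have "e \<in> range T" using rangeI[of T e] by (simp add: Te)
    then have "\<sigma> *\<^sub>R (u - real n *\<^sub>R e) \<in> range T" "0 \<in> range T"
      using sub u by (auto intro!: subspace_scale subspace_diff subspace_0)
    then have "y n \<in> range T"
      using R unfolding y_def rpos_def dedekind_complete_riesz_subspace_def by blast
    then show "T (band_proj_d (y n) e) \<le> band_proj_d (y n) e" by (rule conditional_expectation_band_proj_d_le[OF T y])
    show "\<iota> (band_proj_d (y n) e) \<le> s ^ n *\<^sub>R ?v"
    proof -
      let ?a = "e - r *\<^sub>R (\<sigma> *\<^sub>R (u - real n *\<^sub>R e))"
      have "band_proj_d (y n) e \<le> sup 0 (e - r *\<^sub>R y n)"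
        by (rule band_proj_d_le_truncation[OF y e])
      also have "\<dots> \<le> sup 0 ?a"
        by (intro sup_mono order.refl diff_left_mono scaleR_left_mono r) (simp add: y_def rpos_def)
      finally have "\<iota> (band_proj_d (y n) e) \<le> sup 0 (\<iota> ?a)"
        using universal_completion_le_iff[OF uc, of _ "sup 0 ?a"] \<iota>sup linear_0[OF lin\<iota>] by simp
      also have "\<dots> \<le> s ^ n *\<^sub>R ?v"
      proof (rule sup_least)
        show "0 \<le> s ^ n *\<^sub>R ?v" using s v by (simp add: scaleR_nonneg_nonneg)
        (* ?a is the linear lower bound of exp at (n - u) ln s *)
        have "?a = (1 + real n * ln s) *\<^sub>R e + ln s *\<^sub>R (- u)"
          unfolding \<sigma> by (simp add: algebra_simps)
        then have "\<iota> ?a = (1 + real n * ln s) *\<^sub>R \<iota> e + ln s *\<^sub>R \<iota> (- u)"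
          by (simp only: linear_add[OF lin\<iota>] linear_scale[OF lin\<iota>])
        also have "\<dots> \<le> exp (real n * ln s) *\<^sub>R ?v"
          unfolding riesz_power_def by (rule functional_calculus_exp_ge[OF rep])
        also have "exp (real n * ln s) = s ^ n" using s by (simp add: exp_of_nat_mult)
        finally show "\<iota> ?a \<le> s ^ n *\<^sub>R ?v" .
      qed
      finally show ?thesis .
    qed
    show "inf (band_proj_d ?z e) (proj_eq x (real n *\<^sub>R e) e) \<le> band_proj_d (y n) e"
      unfolding proj_eq_def
    proof (rule band_proj_d_greatest[OF y e])
      let ?w = "rabs (x - real n *\<^sub>R e)"
      let ?c = "inf (band_proj_d ?z e) (band_proj_d ?w e)"
      have c: "0 \<le> ?c" "?c \<le> e"
        using band_proj_d_bounds[OF z e] band_proj_d_bounds[OF rabs_nonneg e] by (auto simp: le_infI1)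
      then show "?c \<le> e" by simp
      have "inf ?c ?z = 0"
        by (rule disjoint_mono[OF band_proj_d_disjoint[OF z e] c(1) inf.cobounded1])
      moreover have "inf ?c ?w = 0"
        by (rule disjoint_mono[OF band_proj_d_disjoint[OF rabs_nonneg e] c(1) inf.cobounded2])
      ultimately have *: "inf (?z + ?w) ?c = 0"
        by (intro disjoint_add) (simp_all add: inf.commute)
      (* where x is on the required side of u and equal to n e, so is n e *)
      have "\<sigma> *\<^sub>R (x - real n *\<^sub>R e) \<le> rabs (\<sigma> *\<^sub>R (x - real n *\<^sub>R e))" by (simp add: rabs_def)
      also have "\<dots> \<le> ?w" using rabs_scaleR_le[of \<sigma> "x - real n *\<^sub>R e"] \<sigma>(2) by simp
      finally have "\<sigma> *\<^sub>R (u - x) + \<sigma> *\<^sub>R (x - real n *\<^sub>R e) \<le> ?z + ?w"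
        by (intro add_mono) (simp_all add: rpos_def)
      then have "\<sigma> *\<^sub>R (u - real n *\<^sub>R e) \<le> ?z + ?w" by (simp add: algebra_simps)
      then have "y n \<le> ?z + ?w" using z rabs_nonneg[of "x - real n *\<^sub>R e"]
        by (simp add: y_def rpos_def[of "_ *\<^sub>R (u - _ *\<^sub>R e)"])
      then show "inf ?c (y n) = 0" using disjoint_mono[OF * y] by (simp add: inf.commute)
    qed
  qed (use band_proj_d_bounds[OF z e] in auto)
qed

theorem theorem16:
  fixes e x u :: "'a::dedekind_riesz"
    and T :: "'a \<Rightarrow> 'a"
    and \<iota> :: "'a \<Rightarrow> 'u::dedekind_f_algebra"
    and \<kappa> :: "'a \<Rightarrow> 's::sup_cone"
    and K :: "'k topology"
    and \<Phi> :: "'u \<Rightarrow> 'k \<Rightarrow> ereal"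
  assumes "conditional_riesz_triple e T"
    and "universal_completion e \<iota>"
    and "C_infinity_representation (\<iota> e) K \<Phi>"
    and "sup_completion \<kappa>"
    and "natural_element e T x"
    and "u \<in> range T"
  shows "(\<forall>s>1. \<kappa> (T (proj_ge x u e)) \<le>
            sup_mult \<iota> \<kappa> (univ_to_sup \<iota> \<kappa> (riesz_power K \<Phi> \<iota> s (- u)))
              (generating_function \<kappa> e T x s)) \<and>
         (\<forall>s. 0 < s \<and> s < 1 \<longrightarrow> \<kappa> (T (proj_le x u e)) \<le>
            sup_mult \<iota> \<kappa> (univ_to_sup \<iota> \<kappa> (riesz_power K \<Phi> \<iota> s (- u)))
              (generating_function \<kappa> e T x s))"
proof (intro conjI allI impI)
  fix s :: real assume "1 < s"
  then show "\<kappa> (T (proj_ge x u e)) \<le>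
      sup_mult \<iota> \<kappa> (univ_to_sup \<iota> \<kappa> (riesz_power K \<Phi> \<iota> s (- u))) (generating_function \<kappa> e T x s)"
    using tail_bound_exponential[OF assms, of s "ln s" 1] by (simp add: proj_ge_def)
next
  fix s :: real assume "0 < s \<and> s < 1"
  then show "\<kappa> (T (proj_le x u e)) \<le>
      sup_mult \<iota> \<kappa> (univ_to_sup \<iota> \<kappa> (riesz_power K \<Phi> \<iota> s (- u))) (generating_function \<kappa> e T x s)"
    using tail_bound_exponential[OF assms, of s "- ln s" "-1"]
    by (simp add: proj_le_def proj_ge_def)
qed

end
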